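(* Let $p_1\ge p_2\ge\cdots>0$ be a non-increasing sequence of strictly positive reals with $\sum_{j=1}^\infty p_j=1$, and let $V_n=\operatorname{Var}(K_n)$, where $K_n$ is the number of boxes occupied by at least one of the first $n$ balls. A finite limit $v:=\lim_{n\to\infty}V_n$ exists if and only if for some integer $k\ge 1$ the frequencies satisfy $$\lim_{j\to\infty}\frac{p_{j+k}}{p_j}=\frac12,$$ and in this case $v=k$.
   Context: Infinite occupancy scheme: balls $1,2,\dots$ are thrown independently at boxes $j=1,2,\dots$, each ball landing in box $j$ with probability $p_j$. $K_n$ is the number of boxes containing at least one of the first $n$ balls; equivalently, the number of distinct values among $n$ i.i.d. positive-integer-valued random variables with distribution $(p_j)$. *)

theory Defs
  imports "HOL-Probability.Probability"
begin

text \<open>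
  Balls and boxes are numbered from 0: \<open>X i \<omega>\<close> is the box that receives ball number \<open>i + 1\<close> of the
  usual numbering, and the boxes \<open>j = 0, 1, \<dots>\<close> carry the frequencies usually written
  \<open>p\<^sub>1, p\<^sub>2, \<dots>\<close>. The first \<open>n\<close> balls are those with index \<open>i < n\<close>.
\<close>

definition occupied_boxes :: "(nat \<Rightarrow> 'a \<Rightarrow> nat) \<Rightarrow> nat \<Rightarrow> 'a \<Rightarrow> nat" where
  "occupied_boxes X n \<omega> = card {j. \<exists>i<n. X i \<omega> = j}"

definition occupancy_variance :: "'a measure \<Rightarrow> (nat \<Rightarrow> 'a \<Rightarrow> nat) \<Rightarrow> nat \<Rightarrow> real" where
  "occupancy_variance M X n = prob_space.variance M (\<lambda>\<omega>. real (occupied_boxes X n \<omega>))"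

end

(* The variance V_n of K_n lies between A_n - R_n and A_n, where A_n = E K_2n - E K_n is the sum over
   the boxes of q_j^n - q_j^(2n), with q_j = 1 - p_j, and R_n = n D_(n-1)^2 bounds the covariances,
   D_n being the probability that ball n + 1 opens a new box. D is decreasing with limit 0 and
   n D_2n <= A_n; hence V is bounded iff A is, in which case R_n -> 0, so V and A have the same limit.
   Writing q_j^n = exp(-n l_j), a ratio limit l_(j+k) / l_j -> 1/2 makes the sum A_n telescope up to k
   boundary terms. Conversely, if A_n -> v, a Karamata-type argument gives
   sum_j (G(q_j^n) - G(q_j^(2n))) -> v G(1) for every C^1 function G with G(0) = 0. In every
   interval near 1 some subinterval of length bounded below avoids all the points n l_j and 2 n l_j;
   with G a step smoothed over that subinterval the sum is an integer, the number of j with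
   x/2 <= n l_j < x. So v is an integer k and these counts equal k. Counting for x slightly
   above and slightly below n l_j, with n about 1 / l_j, pins n l_(j+k) close to 1/2. *)
theory Submission
  imports Defs "HOL-Real_Asymp.Real_Asymp"
begin

section \<open>Box frequencies and expected growth\<close>

text \<open>Used for covariances, with \<open>x = q i * q j\<close> and
  \<open>y = 1 - p i - p j\<close>, whose difference is only \<open>p i * p j\<close>.\<close>

lemma power_diff_le:
  fixes x y :: real
  assumes "0 \<le> y" "y \<le> x"
  shows "x ^ n - y ^ n \<le> real n * (x - y) * x ^ (n - 1)"
proof -
  have "(\<Sum>i<n. y ^ (n - Suc i) * x ^ i) \<le> (\<Sum>i<n. x ^ (n - 1))"
  proof (rule sum_mono)
    fix i assume i: "i \<in> {..<n}"
    hence "y ^ (n - Suc i) * x ^ i \<le> x ^ (n - Suc i) * x ^ i"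
      using assms by (intro mult_right_mono power_mono) auto
    also have "\<dots> = x ^ (n - 1)"
      using i by (simp flip: power_add)
    finally show "y ^ (n - Suc i) * x ^ i \<le> x ^ (n - 1)" .
  qed
  hence "(x - y) * (\<Sum>i<n. y ^ (n - Suc i) * x ^ i) \<le> (x - y) * (real n * x ^ (n - 1))"
    using assms by (intro mult_left_mono) auto
  thus ?thesis
    by (simp add: power_diff_sumr2 mult_ac)
qed

locale box_frequencies =
  fixes p :: "nat \<Rightarrow> real"
  assumes p_antimono: "antimono p" and p_pos: "p j > 0" and p_sums: "p sums 1"
begin

definition q :: "nat \<Rightarrow> real" where "q j = 1 - p j"

text \<open>The expected increase of the number of occupied boxes when ball \<open>n + 1\<close> is
  thrown.\<close>

definition gain :: "nat \<Rightarrow> real" where "gain n = (\<Sum>j. p j * q j ^ n)"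

text \<open>Each summand is also \<open>q j ^ n * (1 - q j ^ n)\<close>, the variance of the
  indicator that box \<open>j\<close> is empty after \<open>n\<close> balls.\<close>

definition growth :: "nat \<Rightarrow> real" where "growth n = (\<Sum>j. q j ^ n - q j ^ (2 * n))"

lemma sum_p_le_1: "finite F \<Longrightarrow> sum p F \<le> 1"
  using sum_le_suminf[of p F] p_sums p_pos by (simp add: sums_iff less_imp_le)

lemma p_add_le_1: "i \<noteq> j \<Longrightarrow> p i + p j \<le> 1"
  using sum_p_le_1[of "{i, j}"] by simp

lemma q_pos: "q j > 0"
  using p_add_le_1[of j "Suc j"] p_pos[of "Suc j"] by (simp add: q_def)

lemma q_less_1: "q j < 1"
  using p_pos[of j] by (simp add: q_def)

lemma q_power_le_1: "q j ^ n \<le> 1"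
  using q_pos[of j] q_less_1[of j] by (intro power_le_one) auto

lemma q_power_mono: "m \<le> n \<Longrightarrow> q j ^ n \<le> q j ^ m"
  using q_pos[of j] q_less_1[of j] by (intro power_decreasing) auto

lemma p_tendsto_0: "p \<longlonglongrightarrow> 0"
  using p_sums summable_LIMSEQ_zero sums_summable by blast

lemma summable_gain: "summable (\<lambda>j. p j * q j ^ n)"
proof (rule summable_comparison_test')
  show "summable p" using p_sums by (simp add: sums_iff)
  fix j show "norm (p j * q j ^ n) \<le> p j"
    using p_pos[of j] q_pos[of j] q_power_le_1[of j n] by (simp add: abs_mult mult_left_le)
qed

text \<open>The difference factors as \<open>q j ^ n * (1 - q j ^ n)\<close>, and
  \<open>1 - q j ^ n\<close> is \<open>p j\<close> times a geometric sum of \<open>n\<close> terms,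
  each between \<open>q j ^ n\<close> and 1.\<close>

lemma power_diff_bounds:
  shows "0 \<le> q j ^ n - q j ^ (2 * n)" "q j ^ n - q j ^ (2 * n) \<le> real n * p j"
    and "real n * (p j * q j ^ (2 * n)) \<le> q j ^ n - q j ^ (2 * n)"
proof -
  show "0 \<le> q j ^ n - q j ^ (2 * n)"
    using q_power_mono[of n "2 * n" j] by simp
  have sq: "q j ^ (2 * n) = q j ^ n * q j ^ n"
    by (simp add: power_add mult_2)
  have eq: "q j ^ n - q j ^ (2 * n) = q j ^ n * (1 - q j ^ n)"
    by (simp add: sq right_diff_distrib)
  have *: "1 - q j ^ n = p j * (\<Sum>i<n. q j ^ i)"
    by (simp add: q_def one_diff_power_eq)
  have "(\<Sum>i<n. q j ^ i) \<le> (\<Sum>i<n. 1)"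
    by (intro sum_mono q_power_le_1)
  hence "1 - q j ^ n \<le> real n * p j"
    unfolding * using p_pos[of j] by (simp add: mult.commute)
  moreover have "q j ^ n * (1 - q j ^ n) \<le> 1 * (1 - q j ^ n)"
    using q_power_le_1 by (intro mult_right_mono) auto
  ultimately show "q j ^ n - q j ^ (2 * n) \<le> real n * p j"
    unfolding eq by simp
  have "(\<Sum>i<n. q j ^ i) \<ge> (\<Sum>i<n. q j ^ n)"
    by (intro sum_mono q_power_mono) auto
  hence "real n * (p j * q j ^ n) \<le> 1 - q j ^ n"
    unfolding * using p_pos[of j] by (simp add: mult_ac)
  hence "q j ^ n * (real n * (p j * q j ^ n)) \<le> q j ^ n * (1 - q j ^ n)"
    using q_pos[of j] by (intro mult_left_mono) auto
  thus "real n * (p j * q j ^ (2 * n)) \<le> q j ^ n - q j ^ (2 * n)"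
    unfolding eq unfolding sq by (simp add: mult_ac)
qed

lemma summable_growth: "summable (\<lambda>j. q j ^ n - q j ^ (2 * n))"
proof (rule summable_comparison_test')
  show "summable (\<lambda>j. real n * p j)"
    using p_sums by (intro summable_mult) (simp add: sums_iff)
  fix j show "norm (q j ^ n - q j ^ (2 * n)) \<le> real n * p j"
    using power_diff_bounds[where j=j and n=n] by simp
qed

lemma growth_nonneg: "growth n \<ge> 0"
  unfolding growth_def using summable_growth power_diff_bounds(1) by (rule suminf_nonneg)

lemma gain_nonneg: "gain n \<ge> 0"
  unfolding gain_def using summable_gain
  by (rule suminf_nonneg) (simp add: p_pos q_pos less_imp_le)

lemma gain_antimono: "m \<le> n \<Longrightarrow> gain n \<le> gain m"
  unfolding gain_def
  by (intro suminf_le summable_gain mult_left_mono q_power_mono) (auto simp: p_pos less_imp_le)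

lemma gain_tendsto_0: "gain \<longlonglongrightarrow> 0"
proof -
  have "(\<lambda>n. \<Sum>j. p j * q j ^ n) \<longlonglongrightarrow> (\<Sum>j. 0)"
  proof (rule tannerys_theorem[of _ _ _ p, THEN conjunct2, THEN conjunct2])
    show "(\<lambda>n. p j * q j ^ n) \<longlonglongrightarrow> 0" for j
      using q_pos[of j] q_less_1[of j] 
      by (intro tendsto_mult_right_zero LIMSEQ_power_zero) auto
    show "summable p" using p_sums by (simp add: sums_iff)
    show "\<forall>\<^sub>F (j, n) in sequentially \<times>\<^sub>F sequentially. norm (p j * q j ^ n) \<le> p j"
      by (intro always_eventually)
        (auto simp: abs_mult p_pos q_pos q_power_le_1 mult_left_le less_imp_le)
  qed auto
  thus ?thesis by (simp add: gain_def[abs_def])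
qed

text \<open>In expectation, balls \<open>n + 1\<close> to \<open>2 * n\<close> each open a new box
  with probability at least \<open>gain (2 * n)\<close>; the proof compares box by box.\<close>

lemma mult_gain_le_growth: "real n * gain (2 * n) \<le> growth n"
  unfolding growth_def gain_def suminf_mult[OF summable_gain, symmetric]
  by (intro suminf_le power_diff_bounds summable_mult summable_gain summable_growth)

text \<open>Bounds the total size of the covariances between distinct boxes, hence the defect of the
  variance from \<open>growth n\<close>.\<close>

definition gap :: "nat \<Rightarrow> real" where "gap n = real n * gain (n - 1) ^ 2"

text \<open>One factor \<open>gain\<close> absorbs \<open>n\<close> and becomes a multiple of
  \<open>growth m\<close>, with \<open>n <= 2 * m + 2\<close> accounting for the extra
  \<open>2 * gain 0\<close>; the other factor stays small. Since \<open>m < n\<close>, the bound can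
  feed an induction.\<close>

lemma gap_le:
  assumes "n \<ge> 1"
  defines "m \<equiv> (n - 1) div 2"
  shows "gap n \<le> (2 * growth m + 2 * gain 0) * gain (2 * m)"
proof -
  have "n \<le> 2 * m + 2" "2 * m \<le> n - 1"
    using assms by auto
  have "gap n = (real n * gain (n - 1)) * gain (n - 1)"
    by (simp add: gap_def power2_eq_square)
  also have "\<dots> \<le> (real (2 * m + 2) * gain (2 * m)) * gain (2 * m)"
    using \<open>n \<le> 2 * m + 2\<close> gain_antimono[OF \<open>2 * m \<le> n - 1\<close>] gain_nonneg
    by (intro mult_mono mult_nonneg_nonneg) (auto simp del: of_nat_add of_nat_mult)
  also have "\<dots> \<le> (2 * growth m + 2 * gain 0) * gain (2 * m)"
    using mult_gain_le_growth[of m] gain_antimono[of 0 "2 * m"] gain_nonneg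
    by (intro mult_right_mono) (auto simp: algebra_simps)
  finally show ?thesis .
qed

lemma gap_nonneg: "gap n \<ge> 0"
  by (simp add: gap_def)

lemma gain_half_tendsto_0: "(\<lambda>n. gain (2 * ((n - 1) div 2))) \<longlonglongrightarrow> 0"
proof (rule filterlim_compose[OF gain_tendsto_0])
  show "filterlim (\<lambda>n::nat. 2 * ((n - 1) div 2)) at_top at_top"
  proof (rule filterlim_at_top_mono)
    show "filterlim (\<lambda>n::nat. n - 2) at_top at_top"
      by (rule filterlim_minus_const_nat_at_top)
  qed (auto intro!: always_eventually)
qed

lemma gap_tendsto_0:
  assumes "Bseq growth"
  shows "gap \<longlonglongrightarrow> 0"
proof -
  obtain C where C: "\<And>n. \<bar>growth n\<bar> \<le> C"
    using assms by (auto simp: Bseq_def)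
  have lim: "(\<lambda>n. (2 * C + 2 * gain 0) * gain (2 * ((n - 1) div 2))) \<longlonglongrightarrow> 0"
    by (rule tendsto_mult_right_zero[OF gain_half_tendsto_0])
  show ?thesis
  proof (rule tendsto_sandwich[OF _ _ tendsto_const lim])
    show "\<forall>\<^sub>F n in sequentially. gap n \<le> (2 * C + 2 * gain 0) * gain (2 * ((n - 1) div 2))"
      using eventually_ge_at_top[of 1]
    proof eventually_elim
      case (elim n)
      have "gap n \<le> (2 * growth ((n - 1) div 2) + 2 * gain 0) * gain (2 * ((n - 1) div 2))"
        by (rule gap_le[OF elim])
      also have "\<dots> \<le> (2 * C + 2 * gain 0) * gain (2 * ((n - 1) div 2))"
        using C[of "(n - 1) div 2"] gain_nonneg by (intro mult_right_mono) auto
      finally show ?case .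
    qed
  qed (simp add: gap_nonneg)
qed

text \<open>By \<open>gap_le\<close>, \<open>growth n\<close> exceeds \<open>V n\<close> by at most
  a small multiple of \<open>growth m\<close> with \<open>m\<close> about \<open>n / 2\<close>, so a
  bound on \<open>V\<close> propagates by strong induction.\<close>

lemma Bseq_growth:
  assumes lower: "\<And>n. growth n - gap n \<le> V n" and "Bseq V"
  shows "Bseq growth"
proof -
  obtain C where C: "\<And>n. \<bar>V n\<bar> \<le> C"
    using \<open>Bseq V\<close> by (auto simp: Bseq_def)
  have "eventually (\<lambda>n. gain (2 * ((n - 1) div 2)) < 1/4) sequentially"
    using order_tendstoD(2)[OF gain_half_tendsto_0, of "1/4"] by simp
  then obtain N where N: "\<And>n. n \<ge> N \<Longrightarrow> gain (2 * ((n - 1) div 2)) < 1/4"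
    by (auto simp: eventually_sequentially)
  define B where "B = Max (growth ` {..N})"
  \<comment> \<open>\<open>D >= 2 * C + gain 0\<close> is exactly what makes the bound reproduce
    itself: \<open>C + (2 * D + 2 * gain 0) / 4 <= D\<close>. The maximum \<open>B\<close> covers
    the start of the induction.\<close>
  define D where "D = max B (2 * C + gain 0)"
  have D: "2 * C + gain 0 \<le> D" by (simp add: D_def)
  have "growth n \<le> D" for n
  proof (induction n rule: less_induct)
    case (less n)
    show ?case
    proof (cases "n \<le> N")
      case True
      thus ?thesis by (auto simp: D_def B_def intro!: max.coboundedI1 Max_ge)
    next
      case False
      define m where "m = (n - 1) div 2"
      have n: "n \<ge> 1" "m < n" "gain (2 * m) \<le> 1/4"
        using False N[of n] by (auto simp: m_def)
      have "growth n \<le> V n + gap n" using lower[of n] by simp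
      also have "\<dots> \<le> C + (2 * growth m + 2 * gain 0) * gain (2 * m)"
        using C[of n] gap_le[OF n(1)] by (auto simp: m_def)
      also have "\<dots> \<le> C + (2 * growth m + 2 * gain 0) * (1/4)"
        using n growth_nonneg[of m] gain_nonneg[of 0] by (intro add_left_mono mult_left_mono) auto
      also have "\<dots> \<le> D"
        using less.IH[OF n(2)] D by argo
      finally show ?thesis .
    qed
  qed
  thus ?thesis
    using growth_nonneg by (intro BseqI'[of _ D]) auto
qed

text \<open>A limit of either sequence makes \<open>growth\<close> bounded; then \<open>gap\<close>
  tends to 0 and squeezes the difference.\<close>

lemma variance_tendsto_iff_growth_tendsto:
  assumes lower: "\<And>n. growth n - gap n \<le> V n" and upper: "\<And>n. V n \<le> growth n"
  shows "V \<longlonglongrightarrow> v \<longleftrightarrow> growth \<longlonglongrightarrow> v"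
proof -
  have lim: "(\<lambda>n. growth n - V n) \<longlonglongrightarrow> 0" if "Bseq growth"
    by (rule tendsto_sandwich[OF _ _ tendsto_const gap_tendsto_0[OF that]])
      (use lower upper in \<open>auto simp: algebra_simps intro!: always_eventually\<close>)
  show ?thesis
  proof
    assume V: "V \<longlonglongrightarrow> v"
    hence "Bseq growth"
      using lower by (intro Bseq_growth[of V] convergent_imp_Bseq) (auto simp: convergent_def)
    from tendsto_add[OF lim[OF this] V] show "growth \<longlonglongrightarrow> v" by simp
  next
    assume growth: "growth \<longlonglongrightarrow> v"
    hence "Bseq growth"
      by (intro convergent_imp_Bseq) (auto simp: convergent_def)
    from tendsto_diff[OF growth lim[OF this]] show "V \<longlonglongrightarrow> v" by simp
  qed
qed

end

section \<open>The variance of the number of occupied boxes\<close>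

locale occupancy_scheme = prob_space M + box_frequencies p
  for M :: "'a measure" and p :: "nat \<Rightarrow> real" +
  fixes X :: "nat \<Rightarrow> 'a \<Rightarrow> nat"
  assumes indep: "indep_vars (\<lambda>_. count_space UNIV) X UNIV"
    and prob_X: "prob {\<omega> \<in> space M. X i \<omega> = j} = p j"
begin

lemma measurable_X [measurable]: "X i \<in> measurable M (count_space UNIV)"
  using indep by (auto simp: indep_vars_def)

definition vacant :: "nat \<Rightarrow> nat set \<Rightarrow> 'a set" where
  "vacant n S = {\<omega> \<in> space M. \<forall>i<n. X i \<omega> \<notin> S}"

lemma sets_vacant [measurable]: "vacant n S \<in> sets M"
  unfolding vacant_def by measurable

lemma prob_X_in:
  assumes "finite S"
  shows "prob {\<omega> \<in> space M. X i \<omega> \<in> S} = sum p S"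
proof -
  have "prob (\<Union>j\<in>S. {\<omega> \<in> space M. X i \<omega> = j}) = (\<Sum>j\<in>S. prob {\<omega> \<in> space M. X i \<omega> = j})"
    using assms by (intro finite_measure_finite_Union) (auto simp: disjoint_family_on_def)
  moreover have "(\<Union>j\<in>S. {\<omega> \<in> space M. X i \<omega> = j}) = {\<omega> \<in> space M. X i \<omega> \<in> S}"
    by auto
  ultimately show ?thesis by (simp add: prob_X)
qed

lemma prob_vacant:
  assumes "finite S"
  shows "prob (vacant n S) = (1 - sum p S) ^ n"
\<comment> \<open>The product rule for independent variables requires a nonempty index set, so no
  balls is a case of its own.\<close>
proof (cases "n = 0")
  case True
  thus ?thesis by (simp add: vacant_def prob_space)
next
  case False
  have "prob (\<Inter>i\<in>{..<n}. X i -` (- S) \<inter> space M) = (\<Prod>i<n. prob (X i -` (- S) \<inter> space M))"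
    using False by (intro indep_varsD[OF indep]) auto
  moreover have "(\<Inter>i\<in>{..<n}. X i -` (- S) \<inter> space M) = vacant n S"
    using False by (auto simp: vacant_def)
  moreover have "prob (X i -` (- S) \<inter> space M) = 1 - sum p S" for i
  proof -
    have "X i -` (- S) \<inter> space M = space M - {\<omega> \<in> space M. X i \<omega> \<in> S}"
      by auto
    thus ?thesis
      using prob_compl[of "{\<omega> \<in> space M. X i \<omega> \<in> S}"] by (simp add: prob_X_in assms)
  qed
  ultimately show ?thesis by simp
qed

lemma integrable_vacant: "integrable M (indicat_real (vacant n S))"
  by (intro integrable_real_indicator) (simp_all add: less_top[symmetric])

text \<open>Infinitely many boxes are vacant, so only those below \<open>J\<close> are counted. Up
  to the constant \<open>J\<close> and a sign this is the number of occupied boxes below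
  \<open>J\<close>, which has the same variance.\<close>

definition vacancies :: "nat \<Rightarrow> nat \<Rightarrow> 'a \<Rightarrow> real" where
  "vacancies n J \<omega> = (\<Sum>j<J. indicator (vacant n {j}) \<omega>)"

lemma measurable_vacancies [measurable]: "vacancies n J \<in> borel_measurable M"
  unfolding vacancies_def[abs_def] by measurable

lemma vacancies_bounds: "0 \<le> vacancies n J \<omega>" "vacancies n J \<omega> \<le> real J"
proof -
  show "0 \<le> vacancies n J \<omega>" by (simp add: vacancies_def sum_nonneg)
  have "vacancies n J \<omega> \<le> (\<Sum>j<J. 1)"
    unfolding vacancies_def by (intro sum_mono) (auto simp: indicator_def)
  thus "vacancies n J \<omega> \<le> real J" by simp
qed

lemma integrable_vacancies: 
  "integrable M (vacancies n J)" "integrable M (\<lambda>\<omega>. (vacancies n J \<omega>)\<^sup>2)"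
proof -
  show "integrable M (vacancies n J)"
    using vacancies_bounds by (intro integrable_const_bound[of _ "real J"]) auto
  show "integrable M (\<lambda>\<omega>. (vacancies n J \<omega>)\<^sup>2)"
    using vacancies_bounds by (intro integrable_const_bound[of _ "(real J)\<^sup>2"]) (auto intro!: power_mono)
qed

text \<open>The covariance of the vacancy indicators of \<open>i\<close> and \<open>j\<close>. For
  \<open>i = j\<close> the set \<open>{i, j}\<close> collapses, which gives the variance.\<close>

definition vacancy_cov :: "nat \<Rightarrow> nat \<Rightarrow> nat \<Rightarrow> real" where
  "vacancy_cov n i j = prob (vacant n {i, j}) - q i ^ n * q j ^ n"

lemma vacancy_cov_diag: "vacancy_cov n i i = q i ^ n - q i ^ (2 * n)"
  by (simp add: vacancy_cov_def prob_vacant q_def power_add mult_2)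

text \<open>Two powers with exponent \<open>n\<close> are compared whose bases
  \<open>1 - p i - p j\<close> and \<open>q i * q j\<close> differ by \<open>p i * p j\<close>:
  monotonicity gives the sign, \<open>power_diff_le\<close> the size.\<close>

lemma vacancy_cov_bounds:
  assumes "i \<noteq> j"
  shows "vacancy_cov n i j \<le> 0"
    and "- (real n * (p i * q i ^ (n - 1)) * (p j * q j ^ (n - 1))) \<le> vacancy_cov n i j"
proof -
  have eq: "vacancy_cov n i j = (1 - p i - p j) ^ n - (q i * q j) ^ n"
    using assms by (simp add: vacancy_cov_def prob_vacant power_mult_distrib diff_diff_eq)
  have diff: "q i * q j - (1 - p i - p j) = p i * p j"
    by (simp add: q_def algebra_simps)
  have le: "0 \<le> 1 - p i - p j" "1 - p i - p j \<le> q i * q j"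
    using p_add_le_1[OF assms] diff mult_pos_pos[OF p_pos[of i] p_pos[of j]] by linarith+
  from power_mono[OF le(2,1)] show "vacancy_cov n i j \<le> 0"
    unfolding eq by simp
  from power_diff_le[OF le, of n]
  show "- (real n * (p i * q i ^ (n - 1)) * (p j * q j ^ (n - 1))) \<le> vacancy_cov n i j"
    unfolding eq diff by (simp add: power_mult_distrib mult_ac)
qed

lemma variance_vacancies: "variance (vacancies n J) = (\<Sum>i<J. \<Sum>j<J. vacancy_cov n i j)"
proof -
  have "expectation (vacancies n J) = (\<Sum>j<J. q j ^ n)"
    unfolding vacancies_def[abs_def] 
    by (subst Bochner_Integration.integral_sum)
      (auto simp: prob_vacant q_def integrable_vacant)
  hence "(expectation (vacancies n J))\<^sup>2 = (\<Sum>i<J. \<Sum>j<J. q i ^ n * q j ^ n)"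
    by (simp add: power2_eq_square sum_product)
  moreover have "expectation (\<lambda>\<omega>. (vacancies n J \<omega>)\<^sup>2) = (\<Sum>i<J. \<Sum>j<J. prob (vacant n {i, j}))"
  proof -
    have "(vacancies n J \<omega>)\<^sup>2 = (\<Sum>i<J. \<Sum>j<J. indicator (vacant n {i, j}) \<omega>)" for \<omega>
      unfolding vacancies_def power2_eq_square sum_product
      by (intro sum.cong refl) (auto simp: vacant_def indicator_def)
    thus ?thesis
      by (simp add: Bochner_Integration.integral_sum integrable_vacant)
  qed
  ultimately show ?thesis
    by (simp add: variance_eq[OF integrable_vacancies] vacancy_cov_def sum_subtractf)
qed

lemma variance_vacancies_le: "variance (vacancies n J) \<le> growth n"
proof -
  have "variance (vacancies n J) \<le> (\<Sum>i<J. \<Sum>j<J. if i = j then q i ^ n - q i ^ (2 * n) else 0)"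
    unfolding variance_vacancies
    by (intro sum_mono) (auto simp: vacancy_cov_diag vacancy_cov_bounds)
  also have "\<dots> = (\<Sum>i<J. q i ^ n - q i ^ (2 * n))"
    by (intro sum.cong) auto
  also have "\<dots> \<le> growth n"
    unfolding growth_def by (intro sum_le_suminf summable_growth power_diff_bounds) auto
  finally show ?thesis .
qed

text \<open>The lower bounds of the covariances are products, so subtracting them on the diagonal
  too, which only lowers the sum, turns the error into \<open>n\<close> times a square, at most
  \<open>gap n\<close>.\<close>

lemma variance_vacancies_ge:
  "(\<Sum>i<J. q i ^ n - q i ^ (2 * n)) - gap n \<le> variance (vacancies n J)"
proof -
  let ?c = "\<lambda>i. p i * q i ^ (n - 1)"
  have c: "?c i \<ge> 0" for i by (simp add: p_pos q_pos less_imp_le)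
  have "(\<Sum>i<J. ?c i) \<le> gain (n - 1)"
    unfolding gain_def using c by (intro sum_le_suminf summable_gain) auto
  hence "real n * (\<Sum>i<J. ?c i)\<^sup>2 \<le> gap n"
    unfolding gap_def using c by (intro mult_left_mono power_mono sum_nonneg) auto
  hence "(\<Sum>i<J. q i ^ n - q i ^ (2 * n)) - gap n
      \<le> (\<Sum>i<J. q i ^ n - q i ^ (2 * n)) - real n * (\<Sum>i<J. ?c i)\<^sup>2"
    by simp
  also have "\<dots> = (\<Sum>i<J. (\<Sum>j<J. if i = j then q i ^ n - q i ^ (2 * n) else 0)
      - (\<Sum>j<J. real n * ?c i * ?c j))"
    by (simp add: sum_subtractf power2_eq_square sum_product sum_distrib_left mult_ac)
  also have "\<dots> = (\<Sum>i<J. \<Sum>j<J. (if i = j then q i ^ n - q i ^ (2 * n) else 0) - real n * ?c i * ?c j)"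
    by (simp add: sum_subtractf)
  also have "\<dots> \<le> variance (vacancies n J)"
    unfolding variance_vacancies
  proof (intro sum_mono)
    fix i j
    show "(if i = j then q i ^ n - q i ^ (2 * n) else 0) - real n * ?c i * ?c j \<le> vacancy_cov n i j"
      using vacancy_cov_bounds(2)[of i j n] c[of i] by (auto simp: vacancy_cov_diag)
  qed
  finally show ?thesis .
qed

section \<open>From truncated vacancy counts to the number of occupied boxes\<close>

lemma vacancies_eq:
  assumes "\<omega> \<in> space M"
  shows "real J - vacancies n J \<omega> = real (card ((\<lambda>i. X i \<omega>) ` {..<n} \<inter> {..<J}))"
proof -
  let ?A = "(\<lambda>i. X i \<omega>) ` {..<n}"
  have "vacancies n J \<omega> = (\<Sum>j<J. if j \<in> - ?A then 1 else 0)"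
    unfolding vacancies_def using assms by (intro sum.cong) (auto simp: vacant_def indicator_def)
  also have "\<dots> = real (card ({..<J} - ?A))"
    by (subst sum.If_cases) (auto simp: Diff_eq Int_def)
  finally show ?thesis
    using card_Int_Diff[of "{..<J}" ?A] by (simp add: Int_commute)
qed

lemma occupied_boxes_eq: "occupied_boxes X n \<omega> = card ((\<lambda>i. X i \<omega>) ` {..<n})"
  unfolding occupied_boxes_def by (rule arg_cong[of _ _ card]) auto

lemma vacancies_tendsto:
  assumes "\<omega> \<in> space M"
  shows "(\<lambda>J. real J - vacancies n J \<omega>) \<longlonglongrightarrow> real (occupied_boxes X n \<omega>)"
proof (rule tendsto_eventually)
  let ?A = "(\<lambda>i. X i \<omega>) ` {..<n}"
  obtain N where "\<And>x. x \<in> ?A \<Longrightarrow> x < N"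
    using finite_nat_set_iff_bounded[of ?A] by auto
  hence "?A \<inter> {..<J} = ?A" if "J \<ge> N" for J
    using that by fastforce
  thus "eventually (\<lambda>J. real J - vacancies n J \<omega> = real (occupied_boxes X n \<omega>)) sequentially"
    by (auto simp: eventually_sequentially vacancies_eq[OF assms] occupied_boxes_eq intro!: exI[of _ N])
qed

lemma abs_card_minus_vacancies_le:
  assumes "\<omega> \<in> space M"
  shows "\<bar>real J - vacancies n J \<omega>\<bar> \<le> real n"
proof -
  have "card ((\<lambda>i. X i \<omega>) ` {..<n} \<inter> {..<J}) \<le> card ((\<lambda>i. X i \<omega>) ` {..<n})"
    by (intro card_mono) auto
  also have "\<dots> \<le> n" using card_image_le[of "{..<n}"] by simp
  finally show ?thesis unfolding vacancies_eq[OF assms] by simp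
qed

text \<open>For each outcome the truncated counts are eventually constant in \<open>J\<close>, and
  they are bounded by \<open>n\<close>; dominated convergence handles the first and second
  moments.\<close>

lemma variance_vacancies_tendsto:
  "(\<lambda>J. variance (vacancies n J)) \<longlonglongrightarrow> occupancy_variance M X n"
proof -
  let ?K = "\<lambda>\<omega>. real (occupied_boxes X n \<omega>)" and ?f = "\<lambda>J \<omega>. real J - vacancies n J \<omega>"
  have meas [measurable]: "?K \<in> borel_measurable M"
    by (rule borel_measurable_LIMSEQ_real[of _ ?f]) (auto intro: vacancies_tendsto)
  have "occupied_boxes X n \<omega> \<le> n" for \<omega>
    unfolding occupied_boxes_eq using card_image_le[of "{..<n}"] by simp
  hence int: "integrable M ?K" "integrable M (\<lambda>\<omega>. (?K \<omega>)\<^sup>2)"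
    by (intro integrable_const_bound[of _ "real n"] integrable_const_bound[of _ "(real n)\<^sup>2"]; 
        auto intro!: power_mono)+
  have int': "integrable M (?f J)" "integrable M (\<lambda>\<omega>. (?f J \<omega>)\<^sup>2)" for J
    using integrable_vacancies[of n J] by (auto simp: power2_diff)
  have lim: "(\<lambda>J. expectation (?f J)) \<longlonglongrightarrow> expectation ?K"
    by (rule integral_dominated_convergence[where w = "\<lambda>_. real n"])
      (auto intro!: AE_I2 vacancies_tendsto abs_card_minus_vacancies_le)
  have "(?f J \<omega>)\<^sup>2 \<le> (real n)\<^sup>2" if "\<omega> \<in> space M" for J \<omega>
    using power_mono[OF abs_card_minus_vacancies_le[OF that, of J n] abs_ge_zero, of 2] by simp
  hence lim2: "(\<lambda>J. expectation (\<lambda>\<omega>. (?f J \<omega>)\<^sup>2)) \<longlonglongrightarrow> expectation (\<lambda>\<omega>. (?K \<omega>)\<^sup>2)"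
    by (intro integral_dominated_convergence[where w = "\<lambda>_. (real n)\<^sup>2"])
      (auto intro!: AE_I2 tendsto_power vacancies_tendsto)
  have "variance (vacancies n J) = variance (?f J)" for J
    using integrable_vacancies[of n J] by (simp add: prob_space power2_commute)
  hence "variance (vacancies n J) = expectation (\<lambda>\<omega>. (?f J \<omega>)\<^sup>2) - (expectation (?f J))\<^sup>2" for J
    by (simp only: variance_eq[OF int'])
  moreover have "occupancy_variance M X n = expectation (\<lambda>\<omega>. (?K \<omega>)\<^sup>2) - (expectation ?K)\<^sup>2"
    unfolding occupancy_variance_def by (rule variance_eq[OF int])
  ultimately show ?thesis
    using tendsto_diff[OF lim2 tendsto_power[OF lim, of 2]] by simp
qed

lemma occupancy_variance_le: "occupancy_variance M X n \<le> growth n"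
  by (rule LIMSEQ_le_const2[OF variance_vacancies_tendsto]) (auto intro: variance_vacancies_le)

lemma occupancy_variance_ge: "growth n - gap n \<le> occupancy_variance M X n"
proof (rule LIMSEQ_le[OF _ variance_vacancies_tendsto])
  show "(\<lambda>J. (\<Sum>i<J. q i ^ n - q i ^ (2 * n)) - gap n) \<longlonglongrightarrow> growth n - gap n"
    unfolding growth_def by (intro tendsto_intros summable_LIMSEQ summable_growth)
qed (auto intro: variance_vacancies_ge)

end

section \<open>Ratio limits are sufficient\<close>

text \<open>A mean value estimate: \<open>x\<close> and \<open>y\<close> are both at least
  \<open>x / 2\<close>, so the slope is at most \<open>exp (- x / 2)\<close> in between.\<close>

lemma exp_neg_diff_le:
  fixes x y :: real
  assumes "x / 2 \<le> y" "0 \<le> x"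
  shows "\<bar>exp (-x) - exp (-y)\<bar> \<le> \<bar>y - x\<bar> * exp (- x / 2)"
proof (cases "x \<le> y")
  case True
  have "exp (-x) * (1 - exp (x - y)) \<le> exp (-x) * (y - x)"
    by (rule mult_left_mono) (use exp_ge_add_one_self[of "x - y"] in linarith, simp)
  also have "\<dots> \<le> exp (-x/2) * (y - x)"
    using True assms by (intro mult_right_mono) auto
  finally show ?thesis
    using True by (simp add: right_diff_distrib mult_exp_exp mult.commute)
next
  case False
  have "exp (-y) * (1 - exp (y - x)) \<le> exp (-y) * (x - y)"
    by (rule mult_left_mono) (use exp_ge_add_one_self[of "y - x"] in linarith, simp)
  also have "\<dots> \<le> exp (-x/2) * (x - y)"
    using False assms by (intro mult_right_mono) auto
  finally show ?thesis
    using False by (simp add: right_diff_distrib mult_exp_exp mult.commute)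
qed

lemma sum_shift_diff:
  fixes f :: "nat \<Rightarrow> real"
  shows "(\<Sum>j<J. f (j + k)) - (\<Sum>j<J. f j) = (\<Sum>i<k. f (J + i)) - (\<Sum>i<k. f i)"
proof (induction J)
  case (Suc J)
  have "(\<Sum>i<k. f (Suc J + i)) + f J = (\<Sum>i<Suc k. f (J + i))"
    by (subst sum.lessThan_Suc_shift) simp
  with Suc show ?case by (simp add: add.commute)
qed simp

text \<open>Since \<open>x j - x (j + k) >= x j / 4\<close>, each term is at most 8 times an
  increment of \<open>exp (- x / 2)\<close> over a shift by \<open>k\<close>, and these telescope.
  The bound depends neither on \<open>J\<close> nor on the scale of \<open>x\<close>.\<close>

lemma sum_mult_exp_le:
  fixes x :: "nat \<Rightarrow> real"
  assumes "\<And>j. 0 \<le> x j" and "\<And>j. x (j + k) \<le> 3/4 * x j"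
  shows "(\<Sum>j<J. x j * exp (- x j / 2)) \<le> 8 * real k"
proof -
  have "(\<Sum>j<J. x j * exp (- x j / 2)) \<le> (\<Sum>j<J. 8 * (exp (- x (j + k) / 2) - exp (- x j / 2)))"
  proof (rule sum_mono)
    fix j
    have "x j / 8 * exp (- x j / 2) \<le> ((x j - x (j + k)) / 2) * exp (- x j / 2)"
      using assms(2)[of j] by (intro mult_right_mono) auto
    also have "\<dots> \<le> (exp ((x j - x (j + k)) / 2) - 1) * exp (- x j / 2)"
      by (rule mult_right_mono) (use exp_ge_add_one_self[of "(x j - x (j + k)) / 2"] in linarith, simp)
    also have "\<dots> = exp (- x (j + k) / 2) - exp (- x j / 2)"
      by (simp add: left_diff_distrib mult_exp_exp diff_divide_distrib)
    finally show "x j * exp (- x j / 2) \<le> 8 * (exp (- x (j + k) / 2) - exp (- x j / 2))"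
      by simp
  qed
  also have "\<dots> = 8 * ((\<Sum>i<k. exp (- x (J + i) / 2)) - (\<Sum>i<k. exp (- x i / 2)))"
    using sum_shift_diff[of "\<lambda>j. exp (- x j / 2)" k J] 
    by (simp add: sum_subtractf flip: sum_distrib_left)
  also have "\<dots> \<le> 8 * ((\<Sum>i<k. 1) - 0)"
    using assms(1) by (intro mult_left_mono diff_mono sum_mono sum_nonneg) auto
  finally show ?thesis by simp
qed

section \<open>Exponential rates and the limit of the growth\<close>

context box_frequencies
begin

definition rate :: "nat \<Rightarrow> real" where "rate j = - ln (q j)"

lemma rate_pos: "rate j > 0"
  using q_pos[of j] q_less_1[of j] by (simp add: rate_def)

lemma rate_antimono: "i \<le> j \<Longrightarrow> rate j \<le> rate i"
  using antimonoD[OF p_antimono, of i j] q_pos[of i] q_pos[of j] by (simp add: rate_def q_def)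

lemma q_power_eq: "q j ^ n = exp (- (real n * rate j))"
  using q_pos[of j] by (simp add: rate_def exp_of_nat_mult)

lemma rate_tendsto_0: "rate \<longlonglongrightarrow> 0"
proof -
  have "(\<lambda>j. - ln (1 - p j)) \<longlonglongrightarrow> - ln (1 - 0)"
    by (intro tendsto_intros p_tendsto_0) auto
  thus ?thesis by (simp add: rate_def[abs_def] q_def)
qed

lemma rate_over_p_tendsto_1: "(\<lambda>j. rate j / p j) \<longlonglongrightarrow> 1"
proof -
  have "filterlim p (at_right 0) sequentially"
    using p_tendsto_0 p_pos by (simp add: filterlim_at less_imp_neq[OF p_pos, symmetric])
  moreover have "((\<lambda>x::real. - ln (1 - x) / x) \<longlongrightarrow> 1) (at_right 0)"
    by real_asymp
  ultimately show ?thesis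
    unfolding rate_def[abs_def] q_def by (rule filterlim_compose[rotated])
qed

text \<open>As \<open>rate j / p j\<close> tends to 1, the two ratios differ by a factor tending to
  1.\<close>

lemma ratio_tendsto_iff:
  "(\<lambda>j. p (j + k) / p j) \<longlonglongrightarrow> c \<longleftrightarrow> (\<lambda>j. rate (j + k) / rate j) \<longlonglongrightarrow> c"
proof -
  let ?h = "\<lambda>j. (rate (j + k) / p (j + k)) / (rate j / p j)"
  have h: "?h \<longlonglongrightarrow> 1 / 1"
    by (intro tendsto_divide rate_over_p_tendsto_1 LIMSEQ_ignore_initial_segment) auto
  have pos: "p j \<noteq> 0" "rate j \<noteq> 0" for j 
    using p_pos[of j] rate_pos[of j] by auto
  show ?thesis
  proof
    assume "(\<lambda>j. p (j + k) / p j) \<longlonglongrightarrow> c"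
    from tendsto_mult[OF h this] show "(\<lambda>j. rate (j + k) / rate j) \<longlonglongrightarrow> c"
      by (simp add: pos)
  next
    assume "(\<lambda>j. rate (j + k) / rate j) \<longlonglongrightarrow> c"
    from tendsto_divide[OF this h] show "(\<lambda>j. p (j + k) / p j) \<longlonglongrightarrow> c"
      by (simp add: pos)
  qed
qed

lemma q_power_tendsto_0: "(\<lambda>n. q j ^ n) \<longlonglongrightarrow> 0"
  using q_pos[of j] q_less_1[of j] by (intro LIMSEQ_power_zero) auto

lemma q_power_double_tendsto_0: "(\<lambda>n. q j ^ (2 * n)) \<longlonglongrightarrow> 0"
  using tendsto_mult[OF q_power_tendsto_0[of j] q_power_tendsto_0[of j]]
  by (simp add: power_add mult_2)

lemma q_tendsto_1: "(\<lambda>j. q j ^ n) \<longlonglongrightarrow> 1"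
proof -
  have "(\<lambda>j. (1 - p j) ^ n) \<longlonglongrightarrow> (1 - 0) ^ n"
    by (intro tendsto_intros p_tendsto_0)
  thus ?thesis by (simp add: q_def)
qed

text \<open>Pairing the term \<open>q j ^ n\<close> with \<open>q (j + k) ^ (2 * n)\<close>, which is close to it, leaves \<open>k\<close>
  unpaired terms \<open>q j ^ (2 * n)\<close> at each end of the sum; those at infinity are close to 1.\<close>

lemma growth_tendsto_of_ratio:
  assumes ratio: "(\<lambda>j. rate (j + k) / rate j) \<longlonglongrightarrow> 1/2"
  shows "growth \<longlonglongrightarrow> real k"
proof (rule LIMSEQ_I)
  fix e :: real assume "e > 0"
  \<comment> \<open>The tail of the paired sum will cost at most \<open>8 * d * real k\<close>, kept
    below \<open>e / 3\<close>. The cap 1/2 yields both \<open>x (j + k) <= 3/4 * x j\<close> and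
    the hypothesis of \<open>exp_neg_diff_le\<close>.\<close>
  define d where "d = min (e / (32 * (real k + 1))) (1/2)"
  have d: "d > 0" "d \<le> 1/2" "8 * d * real k < e / 3"
  proof -
    show "d > 0" "d \<le> 1/2" using \<open>e > 0\<close> unfolding d_def by (simp_all del: min_less_iff_conj add: min_def)
    have "8 * d * real k \<le> 8 * (e / (32 * (real k + 1))) * real k"
      by (intro mult_right_mono) (auto simp: d_def)
    also have "\<dots> < e / 3" using \<open>e > 0\<close> by (simp add: field_simps add_pos_nonneg)
    finally show "8 * d * real k < e / 3" .
  qed
  obtain J0 where J0: "\<And>j. j \<ge> J0 \<Longrightarrow> \<bar>rate (j + k) / rate j - 1/2\<bar> < d / 2"
    using LIMSEQ_D[OF ratio, of "d / 2"] \<open>d > 0\<close> by auto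
  have near: "\<bar>2 * rate (j + k) - rate j\<bar> \<le> d * rate j" if "j \<ge> J0" for j
  proof -
    have "2 * rate (j + k) - rate j = 2 * (rate (j + k) / rate j - 1/2) * rate j"
      using rate_pos[of j] by (simp add: field_simps)
    moreover have "\<bar>2 * (rate (j + k) / rate j - 1/2)\<bar> \<le> d"
      using J0[OF that] unfolding abs_mult by simp
    ultimately show ?thesis
      using rate_pos[of j] by (simp only: abs_mult) (simp add: mult_right_mono)
  qed
  define t where "t = (\<lambda>n j. \<bar>q j ^ n - q (j + k) ^ (2 * n)\<bar>)"
  \<comment> \<open>The estimate is uniform in \<open>n\<close> and \<open>J\<close>, because
    \<open>sum_mult_exp_le\<close> is applied to \<open>x j = n * rate (J0 + j)\<close>.\<close>
  have tail: "(\<Sum>j<J. t n (J0 + j)) \<le> 8 * d * real k" for n J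
  proof -
    define x where "x = (\<lambda>j. real n * rate (J0 + j))"
    have x: "0 \<le> x j" "x (j + k) \<le> 3/4 * x j" "t n (J0 + j) \<le> d * (x j * exp (- x j / 2))" for j
    proof -
      define y where "y = real (2 * n) * rate (J0 + j + k)"
      show "0 \<le> x j" using rate_pos[of "J0 + j"] by (simp add: x_def)
      have "y - x j = real n * (2 * rate (J0 + j + k) - rate (J0 + j))"
        by (simp add: x_def y_def algebra_simps)
      also have "\<bar>\<dots>\<bar> \<le> real n * (d * rate (J0 + j))"
        using near[of "J0 + j"] by (simp add: abs_mult mult_left_mono)
      finally have y: "\<bar>y - x j\<bar> \<le> d * x j" by (simp add: x_def mult_ac)
      also have "\<dots> \<le> 1/2 * x j" using d \<open>0 \<le> x j\<close> by (intro mult_right_mono) auto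
      finally have "\<bar>y - x j\<bar> \<le> x j / 2" by simp
      moreover have "y = 2 * x (j + k)" by (simp add: x_def y_def add.assoc)
      ultimately show "x (j + k) \<le> 3/4 * x j" by linarith
      have "t n (J0 + j) = \<bar>exp (- x j) - exp (- y)\<bar>"
        by (simp only: t_def q_power_eq x_def y_def)
      also have "\<dots> \<le> \<bar>y - x j\<bar> * exp (- x j / 2)"
        using \<open>\<bar>y - x j\<bar> \<le> x j / 2\<close> \<open>0 \<le> x j\<close> by (intro exp_neg_diff_le) linarith+
      also have "\<dots> \<le> d * x j * exp (- x j / 2)"
        using y by (intro mult_right_mono) auto
      finally show "t n (J0 + j) \<le> d * (x j * exp (- x j / 2))" by (simp add: mult.assoc)
    qed
    have "(\<Sum>j<J. t n (J0 + j)) \<le> d * (\<Sum>j<J. x j * exp (- x j / 2))"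
      unfolding sum_distrib_left by (intro sum_mono x)
    also have "\<dots> \<le> d * (8 * real k)"
      using \<open>d > 0\<close> x by (intro mult_left_mono sum_mult_exp_le) auto
    finally show ?thesis by simp
  qed
  have bound: "\<bar>growth n - real k\<bar> \<le> (\<Sum>j<J0. t n j) + (\<Sum>i<k. q i ^ (2 * n)) + 8 * d * real k" for n
  proof -
    let ?S = "\<lambda>J. \<Sum>j<J. q j ^ n - q j ^ (2 * n)"
    let ?B = "(\<Sum>j<J0. t n j) + (\<Sum>i<k. q i ^ (2 * n)) + 8 * d * real k"
    have le: "\<bar>?S (J0 + J) - (\<Sum>i<k. q (J0 + J + i) ^ (2 * n))\<bar> \<le> ?B" for J
    proof -
      have split: "(\<Sum>j<J0 + J. t n j) = (\<Sum>j<J0. t n j) + (\<Sum>j<J. t n (J0 + j))"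
        by (induction J) auto
      have "?S (J0 + J) - (\<Sum>i<k. q (J0 + J + i) ^ (2 * n)) 
          = (\<Sum>j<J0 + J. q j ^ n - q (j + k) ^ (2 * n)) - (\<Sum>i<k. q i ^ (2 * n))"
        using sum_shift_diff[of "\<lambda>j. q j ^ (2 * n)" k "J0 + J"] by (simp add: sum_subtractf)
      also have "\<bar>\<dots>\<bar> \<le> (\<Sum>j<J0 + J. t n j) + (\<Sum>i<k. q i ^ (2 * n))"
        unfolding t_def using q_pos
        by (intro order_trans[OF abs_triangle_ineq4] add_mono sum_abs) (simp add: sum_nonneg less_imp_le)
      finally show ?thesis using tail[of n J] unfolding split by simp
    qed
    \<comment> \<open>With \<open>n\<close> fixed, the \<open>k\<close> unpaired terms at the upper
      end tend to 1 as \<open>J\<close> grows; they produce the limit \<open>k\<close>.\<close>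
    have lim: "(\<lambda>J. \<bar>?S (J0 + J) - (\<Sum>i<k. q (J0 + J + i) ^ (2 * n))\<bar>) \<longlonglongrightarrow> \<bar>growth n - (\<Sum>i<k. 1)\<bar>"
    proof (intro tendsto_intros)
      show "(\<lambda>J. ?S (J0 + J)) \<longlonglongrightarrow> growth n"
        unfolding growth_def add.commute[of J0]
        by (intro LIMSEQ_ignore_initial_segment[of ?S] summable_LIMSEQ summable_growth)
      show "(\<lambda>J. q (J0 + J + i) ^ (2 * n)) \<longlonglongrightarrow> 1" for i
        using LIMSEQ_ignore_initial_segment[OF q_tendsto_1, of "J0 + i" "2 * n"] by (simp add: add_ac)
    qed
    have "\<bar>growth n - (\<Sum>i<k. 1)\<bar> \<le> ?B"
      by (rule LIMSEQ_le_const2[OF lim]) (rule exI[of _ 0], use le in blast)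
    thus ?thesis by simp
  qed
  have "(\<lambda>n. (\<Sum>j<J0. t n j) + (\<Sum>i<k. q i ^ (2 * n))) \<longlonglongrightarrow> (\<Sum>j<J0. \<bar>0 - 0\<bar>) + (\<Sum>i<k. 0)"
    unfolding t_def by (intro tendsto_intros q_power_tendsto_0 q_power_double_tendsto_0)
  hence "(\<lambda>n. (\<Sum>j<J0. t n j) + (\<Sum>i<k. q i ^ (2 * n))) \<longlonglongrightarrow> 0" by simp
  from order_tendstoD(2)[OF this, of "e / 3"] \<open>e > 0\<close>
  obtain N where N: "\<And>n. n \<ge> N \<Longrightarrow> (\<Sum>j<J0. t n j) + (\<Sum>i<k. q i ^ (2 * n)) < e / 3"
    by (auto simp: eventually_sequentially)
  have "norm (growth n - real k) < e" if "n \<ge> N" for n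
    using bound[of n] N[OF that] d(3) \<open>e > 0\<close> by (simp del: of_nat_mult)
  thus "\<exists>N. \<forall>n\<ge>N. norm (growth n - real k) < e" by blast
qed

end

section \<open>Ratio limits are necessary\<close>

lemma has_integral_power_nat:
  fixes a b :: real
  assumes "a \<le> b"
  shows "((\<lambda>x. x ^ i) has_integral (b ^ Suc i - a ^ Suc i) / Suc i) {a..b}"
proof -
  have "((\<lambda>x. x ^ i) has_integral (b ^ Suc i / Suc i - a ^ Suc i / Suc i)) {a..b}"
  proof (rule fundamental_theorem_of_calculus[OF assms])
    fix x :: real
    have "((\<lambda>x. x ^ Suc i / Suc i) has_real_derivative x ^ i) (at x within {a..b})"
      by (rule derivative_eq_intros refl | simp)+
    thus "((\<lambda>x. x ^ Suc i / Suc i) has_vector_derivative x ^ i) (at x within {a..b})"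
      by (simp add: has_real_derivative_iff_has_vector_derivative)
  qed
  thus ?thesis by (simp add: diff_divide_distrib)
qed

lemma has_integral_polynomial:
  fixes a b :: real
  assumes "a \<le> b"
  shows "((\<lambda>x. \<Sum>i\<le>d. c i * x ^ i) has_integral (\<Sum>i\<le>d. c i / Suc i * (b ^ Suc i - a ^ Suc i))) {a..b}"
proof (intro has_integral_sum finite_atMost)
  fix i
  show "((\<lambda>x. c i * x ^ i) has_integral c i / Suc i * (b ^ Suc i - a ^ Suc i)) {a..b}"
    using has_integral_mult_right[OF has_integral_power_nat[OF assms, of i], of "c i"] by simp
qed

section \<open>A Karamata-type limit theorem for weighted growth\<close>

context box_frequencies
begin

text \<open>With \<open>G\<close> a primitive of \<open>g\<close>, this is the sum of
  \<open>G (q j ^ n) - G (q j ^ (2 * n))\<close>; \<open>g = 1\<close> gives back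
  \<open>growth\<close>.\<close>

definition weighted_growth :: "(real \<Rightarrow> real) \<Rightarrow> nat \<Rightarrow> real" where
  "weighted_growth g n = (\<Sum>j. integral {q j ^ (2 * n)..q j ^ n} g)"

lemma q_power_in_unit: "{q j ^ (2 * n)..q j ^ n} \<subseteq> {0..1}"
  using q_power_le_1[of j n] q_pos[of j] by (auto intro: order_trans[of 0 "q j ^ (2 * n)"])

lemma abs_integral_q_le:
  fixes g :: "real \<Rightarrow> real"
  assumes "continuous_on {0..1} g" "\<And>x. x \<in> {0..1} \<Longrightarrow> \<bar>g x\<bar> \<le> C"
  shows "\<bar>integral {q j ^ (2 * n)..q j ^ n} g\<bar> \<le> C * (q j ^ n - q j ^ (2 * n))"
proof -
  have "norm (integral {q j ^ (2 * n)..q j ^ n} g) \<le> C * (q j ^ n - q j ^ (2 * n))"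
  proof (rule integral_bound)
    show "continuous_on {q j ^ (2 * n)..q j ^ n} g"
      by (rule continuous_on_subset[OF assms(1) q_power_in_unit])
    show "norm (g x) \<le> C" if "x \<in> {q j ^ (2 * n)..q j ^ n}" for x
      using assms(2)[of x] subsetD[OF q_power_in_unit that] by simp
  qed (rule q_power_mono, simp)
  thus ?thesis by simp
qed

lemma summable_weighted_growth:
  fixes g :: "real \<Rightarrow> real"
  assumes "continuous_on {0..1} g"
  shows "summable (\<lambda>j. integral {q j ^ (2 * n)..q j ^ n} g)"
proof -
  obtain C where C: "\<And>x. x \<in> {0..1} \<Longrightarrow> \<bar>g x\<bar> \<le> C"
    using compact_imp_bounded[OF compact_continuous_image[OF assms compact_Icc]]
    unfolding bounded_iff by fastforce
  show ?thesis
    by (rule summable_comparison_test'[OF summable_mult[OF summable_growth]])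
      (use abs_integral_q_le[OF assms C] in auto)
qed

text \<open>Integrating \<open>x ^ i\<close> gives \<open>growth (Suc i * n) / Suc i\<close>, which
  is \<open>growth\<close> along a subsequence with the same limit, times the integral of
  \<open>x ^ i\<close> over the unit interval.\<close>

lemma weighted_growth_polynomial:
  assumes "growth \<longlonglongrightarrow> v"
  shows "weighted_growth (\<lambda>x. \<Sum>i\<le>d. c i * x ^ i) \<longlonglongrightarrow> v * integral {0..1} (\<lambda>x. \<Sum>i\<le>d. c i * x ^ i)"
proof -
  have eq: "weighted_growth (\<lambda>x. \<Sum>i\<le>d. c i * x ^ i) n = (\<Sum>i\<le>d. c i / Suc i * growth (Suc i * n))" for n
  proof -
    have "integral {q j ^ (2 * n)..q j ^ n} (\<lambda>x. \<Sum>i\<le>d. c i * x ^ i)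
        = (\<Sum>i\<le>d. c i / Suc i * (q j ^ (Suc i * n) - q j ^ (2 * (Suc i * n))))" for j
      unfolding integral_unique[OF has_integral_polynomial[OF q_power_mono[of n "2 * n" j, simplified]]]
      by (simp add: power_mult[symmetric] mult_ac del: power_Suc mult_Suc mult_Suc_right)
    hence "weighted_growth (\<lambda>x. \<Sum>i\<le>d. c i * x ^ i) n
        = (\<Sum>j. \<Sum>i\<le>d. c i / Suc i * (q j ^ (Suc i * n) - q j ^ (2 * (Suc i * n))))"
      by (simp only: weighted_growth_def)
    also have "\<dots> = (\<Sum>i\<le>d. \<Sum>j. c i / Suc i * (q j ^ (Suc i * n) - q j ^ (2 * (Suc i * n))))"
      by (rule suminf_sum) (intro summable_mult summable_growth)
    also have "\<dots> = (\<Sum>i\<le>d. c i / Suc i * growth (Suc i * n))"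
      unfolding growth_def by (intro sum.cong refl suminf_mult summable_growth)
    finally show ?thesis .
  qed
  have "(\<lambda>n. growth (Suc i * n)) \<longlonglongrightarrow> v" for i
    by (rule filterlim_compose[OF assms mult_nat_left_at_top]) simp
  hence "(\<lambda>n. \<Sum>i\<le>d. c i / Suc i * growth (Suc i * n)) \<longlonglongrightarrow> (\<Sum>i\<le>d. c i / Suc i * v)"
    by (intro tendsto_intros)
  moreover have "(\<Sum>i\<le>d. c i / Suc i * v) = v * integral {0..1} (\<lambda>x. \<Sum>i\<le>d. c i * x ^ i)"
    using integral_unique[OF has_integral_polynomial[of 0 1 c d]]
    by (simp add: sum_distrib_left mult.commute)
  ultimately show ?thesis unfolding eq by simp
qed

text \<open>A Tauberian theorem in the manner of Karamata: monomials are dealt with by rescaling \<open>n\<close>, and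
  a perturbation of \<open>g\<close> by at most \<open>e\<close> changes \<open>weighted_growth g n\<close> by at most \<open>e * growth n\<close>.\<close>

lemma weighted_growth_tendsto:
  assumes v: "growth \<longlonglongrightarrow> v" and g: "continuous_on {0..1} g"
  shows "weighted_growth g \<longlonglongrightarrow> v * integral {0..1} g"
proof (rule LIMSEQ_I)
  fix e :: real assume "e > 0"
  obtain C where C: "C > 0" "\<And>n. \<bar>growth n\<bar> \<le> C"
    using convergent_imp_Bseq[of growth] v by (auto simp: Bseq_def convergent_def)
  \<comment> \<open>A polynomial within \<open>d\<close> of \<open>g\<close> changes the sum by at
    most \<open>d * C\<close> and the limit by at most \<open>\<bar>v\<bar> * d\<close>, together
    \<open>e / 3\<close>.\<close>
  define d where "d = e / (3 * (C + \<bar>v\<bar>))"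
  have "d > 0" using \<open>e > 0\<close> C by (simp add: d_def add_pos_nonneg)
  obtain h where h: "real_polynomial_function h" "\<And>x. x \<in> {0..1} \<Longrightarrow> \<bar>g x - h x\<bar> < d"
    using Stone_Weierstrass_real_polynomial_function[OF _ g \<open>d > 0\<close>] by auto
  obtain c N where h_eq: "h = (\<lambda>x. \<Sum>i\<le>N. c i * x ^ i)"
    using h(1) unfolding real_polynomial_function_iff_sum by blast
  have conth: "continuous_on {0..1} h"
    unfolding h_eq by (intro continuous_intros)
  have diff_integral: "integral S (\<lambda>x. g x - h x) = integral S g - integral S h"
    if "S = {a..b}" "S \<subseteq> {0..1}" for S a b
    using that continuous_on_subset[OF g] continuous_on_subset[OF conth]
    by (intro Henstock_Kurzweil_Integration.integral_diff) (auto intro!: integrable_continuous_real)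
  have cont: "continuous_on {0..1} (\<lambda>x. g x - h x)"
    by (intro continuous_intros g conth)
  have near: "\<bar>weighted_growth g n - weighted_growth h n\<bar> \<le> d * C" for n
  proof -
    let ?D = "\<lambda>j. integral {q j ^ (2 * n)..q j ^ n} (\<lambda>x. g x - h x)"
    have D: "\<bar>?D j\<bar> \<le> d * (q j ^ n - q j ^ (2 * n))" for j
      using h(2) by (intro abs_integral_q_le cont) (auto intro: less_imp_le)
    have "weighted_growth g n - weighted_growth h n = (\<Sum>j. ?D j)"
      unfolding weighted_growth_def
      by (simp add: suminf_diff summable_weighted_growth g conth diff_integral[OF refl q_power_in_unit])
    also have "\<bar>\<dots>\<bar> \<le> (\<Sum>j. d * (q j ^ n - q j ^ (2 * n)))"
    proof (intro order_trans[OF summable_rabs] suminf_le D summable_mult summable_growth)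
      show "summable (\<lambda>j. \<bar>?D j\<bar>)"
        using D by (intro summable_rabs_comparison_test[OF _ summable_mult[OF summable_growth]]) blast
      thus "summable (\<lambda>j. \<bar>?D j\<bar>)" .
    qed
    also have "\<dots> = d * growth n"
      unfolding growth_def by (intro suminf_mult summable_growth)
    also have "\<dots> \<le> d * C" using C(2)[of n] \<open>d > 0\<close> by (intro mult_left_mono) auto
    finally show ?thesis .
  qed
  have "\<bar>integral {0..1} g - integral {0..1} h\<bar> \<le> d"
    using integral_bound[of 0 1 "\<lambda>x. g x - h x" d] cont h(2)
    by (auto simp: diff_integral less_imp_le)
  hence "\<bar>v * integral {0..1} h - v * integral {0..1} g\<bar> \<le> \<bar>v\<bar> * d"
    by (simp add: mult_left_mono abs_minus_commute flip: right_diff_distrib abs_mult)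
      (simp add: abs_mult abs_minus_commute mult_left_mono)
  moreover have "d * C + \<bar>v\<bar> * d = e / 3"
  proof -
    have "d * (C + \<bar>v\<bar>) = e / 3" using C(1) by (simp add: d_def field_simps)
    thus ?thesis by (simp add: algebra_simps)
  qed
  ultimately have close: "\<bar>weighted_growth g n - v * integral {0..1} g\<bar>
      \<le> \<bar>weighted_growth h n - v * integral {0..1} h\<bar> + e / 3" for n
    using near[of n] by linarith
  obtain N0 where N0: "\<And>n. n \<ge> N0 \<Longrightarrow> \<bar>weighted_growth h n - v * integral {0..1} h\<bar> < e / 3"
    using LIMSEQ_D[OF weighted_growth_polynomial[OF v, of c N], of "e / 3"] \<open>e > 0\<close>
    unfolding h_eq by auto
  have "norm (weighted_growth g n - v * integral {0..1} g) < e" if "n \<ge> N0" for n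
    using close[of n] N0[OF that] \<open>e > 0\<close> by simp
  thus "\<exists>N0. \<forall>n\<ge>N0. norm (weighted_growth g n - v * integral {0..1} g) < e" by blast
qed

text \<open>Every counted \<open>j\<close> contributes \<open>q j ^ n * (1 - q j ^ n)\<close>, at
  least \<open>exp (-b) * (1 - exp (-a))\<close>, to \<open>growth n\<close>.\<close>

lemma card_window_le:
  assumes "\<And>n. growth n \<le> C" "0 < a" "a \<le> b"
  shows "finite {j. a \<le> real n * rate j \<and> real n * rate j \<le> b}" (is "finite ?J")
    and "real (card {j. a \<le> real n * rate j \<and> real n * rate j \<le> b}) \<le> C / (exp (-b) * (1 - exp (-a)))"
proof -
  have "(\<lambda>j. real n * rate j) \<longlonglongrightarrow> real n * 0"
    by (intro tendsto_intros rate_tendsto_0)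
  hence "eventually (\<lambda>j. real n * rate j < a) sequentially"
    using \<open>0 < a\<close> by (intro order_tendstoD(2)) auto
  then obtain N where "\<And>j. j \<ge> N \<Longrightarrow> real n * rate j < a"
    by (auto simp: eventually_sequentially)
  hence "?J \<subseteq> {..<N}" by (force simp: not_le[symmetric])
  thus fin: "finite ?J" by (rule finite_subset[OF _ finite_lessThan])
  define m where "m = exp (-b) * (1 - exp (-a))"
  have "m > 0" using \<open>0 < a\<close> by (simp add: m_def)
  have "real (card ?J) * m = (\<Sum>j\<in>?J. m)" by simp
  also have "\<dots> \<le> (\<Sum>j\<in>?J. q j ^ n - q j ^ (2 * n))"
  proof (rule sum_mono)
    fix j assume j: "j \<in> ?J"
    have "m \<le> q j ^ n * (1 - q j ^ n)"
      unfolding m_def q_power_eq using j \<open>0 < a\<close> by (intro mult_mono) auto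
    thus "m \<le> q j ^ n - q j ^ (2 * n)"
      by (simp add: power_add mult_2 right_diff_distrib)
  qed
  also have "\<dots> \<le> growth n"
    unfolding growth_def by (intro sum_le_suminf fin summable_growth power_diff_bounds)
  finally have "real (card ?J) * m \<le> C" using assms(1)[of n] by simp
  thus "real (card ?J) \<le> C / (exp (-b) * (1 - exp (-a)))"
    using \<open>m > 0\<close> by (simp add: m_def[symmetric] pos_le_divide_eq)
qed

end

section \<open>Smoothed steps and counting boxes in a window\<close>

definition bump :: "real \<Rightarrow> real \<Rightarrow> real \<Rightarrow> real" where
  "bump a b x = max 0 ((x - a) * (b - x))"

lemma continuous_on_bump: "continuous_on S (bump a b)"
  unfolding bump_def[abs_def] by (intro continuous_intros)

lemma bump_eq_0: "a \<le> b \<Longrightarrow> x \<le> a \<or> b \<le> x \<Longrightarrow> bump a b x = 0"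
  unfolding bump_def by (rule max_absorb1) (auto simp: mult_le_0_iff)

text \<open>This integral is the height of the smoothed step; being positive, it can be divided out
  to recover a count.\<close>

lemma integral_bump_pos:
  assumes "a < b"
  shows "integral {a..b} (bump a b) > 0"
proof -
  have nonneg: "bump a b x \<ge> 0" for x by (simp add: bump_def)
  have "bump a b ((a + b) / 2) > 0"
    using assms by (auto simp: bump_def less_max_iff_disj intro!: mult_pos_pos)
  hence "integral {a..b} (bump a b) \<noteq> 0"
    using integral_eq_0_iff[OF continuous_on_bump assms nonneg] assms
    by (auto intro!: bexI[of _ "(a + b) / 2"])
  moreover have "integral {a..b} (bump a b) \<ge> 0"
    by (intro integral_nonneg integrable_continuous_real continuous_on_bump nonneg)
  ultimately show ?thesis by simp
qed

lemma integral_bump_inside: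
  assumes "a \<le> b" "s \<le> a" "b \<le> t"
  shows "integral {s..t} (bump a b) = integral {a..b} (bump a b)"
proof (rule integral_unique, rule has_integral_on_superset)
  show "(bump a b has_integral integral {a..b} (bump a b)) {a..b}"
    by (intro integrable_integral integrable_continuous_real continuous_on_bump)
qed (use assms in \<open>auto intro: bump_eq_0\<close>)

lemma integral_bump_outside:
  assumes "a \<le> b" "t \<le> a \<or> b \<le> s"
  shows "integral {s..t} (bump a b) = 0"
  by (rule integral_unique, rule has_integral_is_0) (use assms in \<open>auto intro!: bump_eq_0\<close>)

text \<open>Pigeonhole: points chosen from \<open>m\<close> disjoint open cells would be distinct,
  but \<open>P\<close> has fewer than \<open>m\<close>.\<close>

lemma obtain_free_subinterval:
  fixes a b :: real
  assumes "finite P" "card P < m"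
  defines "h \<equiv> (b - a) / real m"
  obtains r where "r < m" "P \<inter> {a + real r * h<..<a + real (Suc r) * h} = {}"
proof (rule ccontr)
  assume "\<not> thesis"
  hence "\<forall>r\<in>{..<m}. \<exists>z. z \<in> P \<and> a + real r * h < z \<and> z < a + real (Suc r) * h"
    using that by fastforce
  then obtain z where z: "\<And>r. r < m \<Longrightarrow> z r \<in> P"
      "\<And>r. r < m \<Longrightarrow> a + real r * h < z r" "\<And>r. r < m \<Longrightarrow> z r < a + real (Suc r) * h"
    by (auto simp: bchoice_iff)
  have "z r < z s" if "r < s" "s < m" for r s
  proof -
    have "h > 0"
      using z(2)[of s] z(3)[of s] that by (simp add: algebra_simps)
    hence "real (Suc r) * h \<le> real s * h"
      using that by (intro mult_right_mono) auto
    thus ?thesis using z(3)[of r] z(2)[of s] that by linarith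
  qed
  hence "inj_on z {..<m}"
    by (intro linorder_inj_onI) (auto simp: less_imp_neq)
  hence "card {..<m} \<le> card P"
    using z(1) \<open>finite P\<close> by (intro card_inj_on_le) auto
  with assms(2) show False by simp
qed

context box_frequencies
begin

text \<open>Equivalently, \<open>exp (-x)\<close> lies in the half-open interval from
  \<open>q j ^ (2 * n)\<close>, included, to \<open>q j ^ n\<close>, excluded.\<close>

definition window :: "nat \<Rightarrow> real \<Rightarrow> nat set" where
  "window n x = {j. x / 2 \<le> real n * rate j \<and> real n * rate j < x}"

text \<open>Makes \<open>card (window n x)\<close> a genuine count, since \<open>card\<close> is 0
  on infinite sets.\<close>

lemma finite_window:
  assumes "growth \<longlonglongrightarrow> v" "x > 0"
  shows "finite (window n x)"
proof -
  obtain C where "\<And>n. \<bar>growth n\<bar> \<le> C"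
    using convergent_imp_Bseq[of growth] assms by (auto simp: Bseq_def convergent_def)
  hence "growth n \<le> C" for n by (meson abs_le_iff)
  from card_window_le(1)[OF this, of "x / 2" x n] show ?thesis
    using assms by (auto simp: window_def elim!: rev_finite_subset)
qed

text \<open>If no \<open>n * rate j\<close> and no \<open>2 * n * rate j\<close> lies in \<open>(a, b)\<close>, then the logarithmic image of
  \<open>(a, b)\<close> lies entirely inside or entirely outside each interval \<open>[q j ^ (2 * n), q j ^ n]\<close>.\<close>

lemma weighted_growth_bump:
  assumes ab: "0 < a" "a < b" and x: "a < x" "x < b" and fin: "finite (window n x)"
    and free: "\<And>j. real n * rate j \<notin> {a<..<b}" "\<And>j. 2 * (real n * rate j) \<notin> {a<..<b}"
  shows "weighted_growth (bump (exp (-b)) (exp (-a))) n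
    = integral {exp (-b)..exp (-a)} (bump (exp (-b)) (exp (-a))) * real (card (window n x))"
proof -
  let ?g = "bump (exp (-b)) (exp (-a))"
  let ?c = "integral {exp (-b)..exp (-a)} ?g"
  have "integral {q j ^ (2 * n)..q j ^ n} ?g = (if j \<in> window n x then ?c else 0)" for j
  proof -
    define y where "y = real n * rate j"
    have q: "q j ^ n = exp (-y)" "q j ^ (2 * n) = exp (- 2 * y)"
      by (simp_all add: q_power_eq y_def)
    have y: "y \<le> a \<or> b \<le> y" "2 * y \<le> a \<or> b \<le> 2 * y"
      using free[of j] by (auto simp: y_def)
    \<comment> \<open>As neither \<open>y\<close> nor \<open>2 * y\<close> lies between
      \<open>a\<close> and \<open>b\<close>, comparing them with \<open>x\<close> is the same as
      comparing them with the endpoints.\<close>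
    have win: "j \<in> window n x \<longleftrightarrow> y \<le> a \<and> b \<le> 2 * y"
      using y x by (auto simp: window_def y_def)
    show ?thesis
    proof (cases "y \<le> a \<and> b \<le> 2 * y")
      case True
      thus ?thesis using ab unfolding q win by (auto intro!: integral_bump_inside)
    next
      case False
      thus ?thesis using ab y unfolding q win by (auto intro!: integral_bump_outside)
    qed
  qed
  hence "weighted_growth ?g n = (\<Sum>j\<in>window n x. ?c)"
    unfolding weighted_growth_def by (subst suminf_finite[OF fin]) auto
  thus ?thesis by simp
qed

text \<open>The limit theorem concerns a fixed function, while the free subinterval varies with
  \<open>n\<close>. So the interval is cut into \<open>m\<close> fixed cells; eventually all
  \<open>m\<close> limits are close at once, and for each such \<open>n\<close> some cell is
  free.\<close>

lemma eventually_card_window_near: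
  assumes v: "growth \<longlonglongrightarrow> v" and ab: "1/2 \<le> a" "a < b" "b \<le> 2" and "e > 0"
  shows "\<forall>\<^sub>F n in sequentially. \<exists>x. a < x \<and> x < b \<and> \<bar>real (card (window n x)) - v\<bar> < e"
proof -
  obtain C where C: "\<And>n. \<bar>growth n\<bar> \<le> C"
    using convergent_imp_Bseq[of growth] v by (auto simp: Bseq_def convergent_def)
  hence C': "growth n \<le> C" for n by (meson abs_le_iff)
  \<comment> \<open>Only \<open>j\<close> with \<open>n * rate j\<close> between 1/4 and 2 can put
    \<open>n * rate j\<close> or its double between \<open>a\<close> and \<open>b\<close>. There are
    at most \<open>B\<close> of them, giving fewer than \<open>m\<close> points.\<close>
  define B where "B = C / (exp (-2) * (1 - exp (-(1/4))))"
  define m where "m = Suc (2 * nat \<lceil>B\<rceil>)"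
  define h where "h = (b - a) / real m"
  have "h > 0" using ab by (simp add: h_def m_def)
  define l where "l r = a + real r * h" for r
  have l: "a \<le> l r" "l r < l (Suc r)" "l (Suc r) \<le> b" "l (Suc r) - l r = h" if "r < m" for r
  proof -
    show "a \<le> l r" "l r < l (Suc r)" "l (Suc r) - l r = h" using \<open>h > 0\<close> by (auto simp: l_def algebra_simps)
    have "real (Suc r) * h \<le> real m * h" using that \<open>h > 0\<close> by (intro mult_right_mono) auto
    thus "l (Suc r) \<le> b" by (simp add: l_def h_def m_def)
  qed
  define g where "g r = bump (exp (- l (Suc r))) (exp (- l r))" for r
  define c where "c r = integral {exp (- l (Suc r))..exp (- l r)} (g r)" for r
  have c_pos: "c r > 0" if "r < m" for r
    unfolding c_def g_def using l[OF that] by (intro integral_bump_pos) auto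
  have "\<forall>\<^sub>F n in sequentially. \<forall>r\<in>{..<m}. \<bar>weighted_growth (g r) n - v * c r\<bar> < e * c r"
  proof (rule eventually_ball_finite, simp, safe)
    fix r assume r: "r < m"
    have "integral {0..1} (g r) = c r"
      unfolding c_def g_def using l[OF r] ab by (intro integral_bump_inside) auto
    hence "weighted_growth (g r) \<longlonglongrightarrow> v * c r"
      using weighted_growth_tendsto[OF v continuous_on_bump, of "exp (- l (Suc r))" "exp (- l r)"]
      by (simp add: g_def)
    from tendstoD[OF this, of "e * c r"] 
    show "\<forall>\<^sub>F n in sequentially. \<bar>weighted_growth (g r) n - v * c r\<bar> < e * c r"
      using \<open>e > 0\<close> c_pos[OF r] by (simp add: dist_real_def)
  qed
  thus ?thesis
  proof eventually_elim
    case (elim n)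
    define J where "J = {j. 1/4 \<le> real n * rate j \<and> real n * rate j \<le> 2}"
    define P where "P = (\<lambda>j. real n * rate j) ` J \<union> (\<lambda>j. 2 * (real n * rate j)) ` J"
    have J: "finite J" "real (card J) \<le> B"
      using card_window_le[OF C', of "1/4" 2 n] by (auto simp: J_def B_def)
    have "finite P" using J by (simp add: P_def)
    have "card P \<le> card J + card J"
      unfolding P_def by (intro order_trans[OF card_Un_le] add_mono card_image_le J)
    also have "card J \<le> nat \<lceil>B\<rceil>" using J(2) by linarith
    finally have "card P < m" by (simp add: m_def)
    obtain r where r: "r < m" and free: "P \<inter> {l r<..<l (Suc r)} = {}"
      using obtain_free_subinterval[OF \<open>finite P\<close> \<open>card P < m\<close>, of a b] 
      unfolding l_def h_def by blast
    have P: "real n * rate j \<notin> {l r<..<l (Suc r)}" "2 * (real n * rate j) \<notin> {l r<..<l (Suc r)}" for j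
    proof -
      have "1/4 \<le> real n * rate j \<and> real n * rate j \<le> 2"
        if "real n * rate j \<in> {l r<..<l (Suc r)} \<or> 2 * (real n * rate j) \<in> {l r<..<l (Suc r)}"
        using that l[OF r] ab by auto
      hence "j \<in> J"
        if "real n * rate j \<in> {l r<..<l (Suc r)} \<or> 2 * (real n * rate j) \<in> {l r<..<l (Suc r)}"
        using that by (auto simp: J_def)
      with free show "real n * rate j \<notin> {l r<..<l (Suc r)}" "2 * (real n * rate j) \<notin> {l r<..<l (Suc r)}"
        unfolding P_def by blast+
    qed
    define x where "x = (l r + l (Suc r)) / 2"
    have x: "l r < x" "x < l (Suc r)" using l[OF r] by (auto simp: x_def)
    have "weighted_growth (g r) n = c r * real (card (window n x))"
      unfolding g_def c_def using l[OF r] x ab P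
      by (intro weighted_growth_bump finite_window[OF v]) auto
    hence "\<bar>(real (card (window n x)) - v) * c r\<bar> < e * c r"
      using bspec[OF elim, of r] r by (simp add: algebra_simps)
    hence "\<bar>real (card (window n x)) - v\<bar> < e"
      using c_pos[OF r] by (simp add: abs_mult)
    thus ?case using x l[OF r] by (intro exI[of _ x]) auto
  qed
qed

text \<open>Window counts are natural numbers arbitrarily close to \<open>v\<close>. One within 1/2
  of \<open>v\<close> must equal \<open>v\<close>: a closer one would differ from it by less than
  1.\<close>

lemma growth_limit_nat:
  assumes "growth \<longlonglongrightarrow> v"
  obtains k :: nat where "v = real k"
proof -
  have near: "\<exists>k::nat. \<bar>real k - v\<bar> < e" if "e > 0" for e
    using eventually_happens[OF eventually_card_window_near[OF assms _ _ _ that, of 1 2]] by auto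
  obtain k :: nat where k: "\<bar>real k - v\<bar> < 1/2" using near[of "1/2"] by auto
  have "v = real k"
  proof (rule ccontr)
    assume "v \<noteq> real k"
    hence "min (1/2) \<bar>real k - v\<bar> > 0" by simp
    from near[OF this] obtain i :: nat where "\<bar>real i - v\<bar> < 1/2" "\<bar>real i - v\<bar> < \<bar>real k - v\<bar>" by auto
    moreover from this k have "i = k" by linarith
    ultimately show False by simp
  qed
  thus ?thesis using that by blast
qed

lemma eventually_card_window:
  assumes "growth \<longlonglongrightarrow> real k" "1/2 \<le> a" "a < b" "b \<le> 2"
  shows "\<forall>\<^sub>F n in sequentially. \<exists>x. a < x \<and> x < b \<and> card (window n x) = k"
  using eventually_card_window_near[OF assms zero_less_one]
proof eventually_elim
  case (elim n)
  then obtain x where "a < x" "x < b" "\<bar>real (card (window n x)) - real k\<bar> < 1" by auto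
  thus ?case by (intro exI[of _ x]) auto
qed

section \<open>From window counts to the ratio limit\<close>

definition scale :: "nat \<Rightarrow> nat" where "scale j = nat \<lceil>1 / rate j\<rceil>"

text \<open>\<open>scale j\<close> is the least \<open>n\<close> with
  \<open>n * rate j >= 1\<close>; the overshoot is at most one step \<open>rate j\<close>, which
  tends to 0.\<close>

lemma scale_bounds: "1 \<le> real (scale j) * rate j" "real (scale j) * rate j \<le> 1 + rate j"
proof -
  have "1 / rate j \<le> real (scale j)" "real (scale j) \<le> 1 / rate j + 1"
    unfolding scale_def using rate_pos[of j] by (auto simp: of_nat_nat)
  thus "1 \<le> real (scale j) * rate j" "real (scale j) * rate j \<le> 1 + rate j"
    using rate_pos[of j] by (auto simp: field_simps)
qed

lemma filterlim_scale: "filterlim scale at_top sequentially"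
proof -
  have "filterlim (\<lambda>j. inverse (rate j)) at_top sequentially"
    by (intro filterlim_inverse_at_top rate_tendsto_0) (auto simp: rate_pos)
  hence "filterlim (\<lambda>j. real (scale j)) at_top sequentially"
    by (rule filterlim_at_top_mono)
      (use scale_bounds(1) rate_pos in \<open>auto simp: field_simps intro!: always_eventually\<close>)
  thus ?thesis by (simp add: filterlim_sequentially_iff_filterlim_real)
qed

lemma scaled_rate_antimono: "i \<le> j \<Longrightarrow> real n * rate j \<le> real n * rate i"
  by (intro mult_left_mono rate_antimono) auto

text \<open>Here \<open>x\<close> is just above \<open>n * rate j\<close>, so \<open>j\<close> is in
  the window. Windows consist of consecutive indices by monotonicity; with only \<open>k\<close>
  members, \<open>j + k\<close> has dropped out, below \<open>x / 2\<close>.\<close>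

lemma window_above:
  assumes "growth \<longlonglongrightarrow> v" and x: "1 + e < x" "x < 1 + 2 * e" and e: "0 < e" "e \<le> 1/4"
    and j: "rate j < e"
  defines "n \<equiv> scale j"
  assumes card: "card (window n x) = k"
  shows "k \<ge> 1" "real n * rate (j + k) \<le> 1/2 + e"
proof -
  have fin: "finite (window n x)" using x e by (intro finite_window[OF assms(1)]) auto
  have mem: "j \<in> window n x"
    using scale_bounds[of j] x e j by (auto simp: window_def n_def)
  with fin card show "k \<ge> 1"
    by (metis One_nat_def Suc_leI card_gt_0_iff empty_iff)
  show "real n * rate (j + k) \<le> 1/2 + e"
  proof (rule ccontr)
    assume "\<not> ?thesis"
    hence "x / 2 \<le> real n * rate (j + k)" using x by simp
    have "{j..j + k} \<subseteq> window n x"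
    proof
      fix i assume i: "i \<in> {j..j + k}"
      with \<open>x / 2 \<le> _\<close> mem show "i \<in> window n x"
        using scaled_rate_antimono[of j i n] scaled_rate_antimono[of i "j + k" n]
        by (auto simp: window_def)
    qed
    from card_mono[OF fin this] card show False by simp
  qed
qed

text \<open>Here \<open>x\<close> is below \<open>n * rate j\<close>, so all members come after
  \<open>j\<close>. Were \<open>n * rate (j + k)\<close> below \<open>1/2 - e\<close>, they would
  also come before \<open>j + k\<close>, leaving at most \<open>k - 1\<close> of them.\<close>

lemma window_below:
  fixes j :: nat
  assumes "k \<ge> 1" "1 - 2 * e < x" "x < 1 - e" "0 < e"
  defines "n \<equiv> scale j"
  assumes card: "card (window n x) = k"
  shows "1/2 - e \<le> real n * rate (j + k)"
proof (rule ccontr)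
  assume *: "\<not> ?thesis"
  have "window n x \<subseteq> {j<..<j + k}"
  proof
    fix i assume i: "i \<in> window n x"
    have "real n * rate (j + k) < real n * rate i" "real n * rate i < real n * rate j"
      using i * assms scale_bounds[of j] by (auto simp: window_def)
    thus "i \<in> {j<..<j + k}"
      using scaled_rate_antimono[of i j n] scaled_rate_antimono[of "j + k" i n] by force
  qed
  from card_mono[OF _ this] card assms(1) show False by simp
qed

lemma ratio_tendsto_of_growth:
  assumes "growth \<longlonglongrightarrow> v"
  obtains k where "k \<ge> 1" "(\<lambda>j. rate (j + k) / rate j) \<longlonglongrightarrow> 1/2"
proof -
  obtain k where k: "growth \<longlonglongrightarrow> real k" using assms growth_limit_nat by metis
  \<comment> \<open>The claim \<open>k >= 1\<close> is carried along because it comes from a window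
    that contains \<open>j\<close>. The lower bound is divided by \<open>1 + e\<close> because
    \<open>scale j * rate j\<close> may reach that value.\<close>
  have ev: "\<forall>\<^sub>F j in sequentially. k \<ge> 1 \<and> (1/2 - e) / (1 + e) \<le> rate (j + k) / rate j
      \<and> rate (j + k) / rate j \<le> 1/2 + e" if e: "0 < e" "e \<le> 1/4" for e
  proof -
    have above: "\<forall>\<^sub>F j in sequentially. \<exists>x. 1 + e < x \<and> x < 1 + 2 * e \<and> card (window (scale j) x) = k"
      using e by (intro eventually_compose_filterlim[OF eventually_card_window[OF k] filterlim_scale]) auto
    have below: "\<forall>\<^sub>F j in sequentially. \<exists>x. 1 - 2 * e < x \<and> x < 1 - e \<and> card (window (scale j) x) = k"
      using e by (intro eventually_compose_filterlim[OF eventually_card_window[OF k] filterlim_scale]) auto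
    have small: "\<forall>\<^sub>F j in sequentially. rate j < e"
      by (rule order_tendstoD(2)[OF rate_tendsto_0 e(1)])
    show ?thesis
      using above below small
    proof eventually_elim
      case (elim j)
      let ?n = "real (scale j)"
      obtain x x' where x: "1 + e < x" "x < 1 + 2 * e" "card (window (scale j) x) = k"
        and x': "1 - 2 * e < x'" "x' < 1 - e" "card (window (scale j) x') = k"
        using elim by auto
      note ab = window_above[OF k x(1,2) e elim(3) x(3)]
      note be = window_below[OF ab(1) x'(1,2) e(1) x'(3)]
      have n: "1 \<le> ?n * rate j" "?n * rate j \<le> 1 + e"
        using scale_bounds[of j] elim(3) by auto
      have eq: "rate (j + k) / rate j = (?n * rate (j + k)) / (?n * rate j)"
        using n by auto
      have "(1/2 - e) / (1 + e) \<le> (?n * rate (j + k)) / (?n * rate j)"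
        using be n e by (intro frac_le) auto
      moreover have "(?n * rate (j + k)) / (?n * rate j) \<le> (1/2 + e) / 1"
        using ab n e by (intro frac_le) auto
      ultimately show ?case using ab(1) unfolding eq by simp
    qed
  qed
  have "k \<ge> 1" using eventually_happens[OF ev[of "1/4"]] by auto
  moreover have "(\<lambda>j. rate (j + k) / rate j) \<longlonglongrightarrow> 1/2"
  proof (rule tendstoI)
    fix d :: real assume "d > 0"
    define e where "e = min (d / 3) (1/4)"
    have e: "0 < e" "e \<le> 1/4" "3 * e \<le> d" using \<open>d > 0\<close> by (auto simp: e_def)
    \<comment> \<open>Multiplying out,
      \<open>(1/2 - 2 * e) * (1 + e) = 1/2 - 3/2 * e - 2 * e^2\<close>, which is below
      \<open>1/2 - e\<close>.\<close>
    have lo: "1/2 - 2 * e < (1/2 - e) / (1 + e)"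
      using e by (simp add: field_simps add_pos_pos)
    show "\<forall>\<^sub>F j in sequentially. dist (rate (j + k) / rate j) (1/2) < d"
      using ev[OF e(1,2)]
    proof eventually_elim
      case (elim j)
      thus ?case using lo e by (auto simp: dist_real_def abs_less_iff)
    qed
  qed
  ultimately show ?thesis using that by blast
qed

end

theorem theorem1p1:
  fixes M :: "'a measure"
    and X :: "nat \<Rightarrow> 'a \<Rightarrow> nat"
    and p :: "nat \<Rightarrow> real"
  assumes "prob_space M"
    and "prob_space.indep_vars M (\<lambda>_. count_space UNIV) X UNIV"
    and "\<And>i j. measure M {\<omega> \<in> space M. X i \<omega> = j} = p j"
    and "antimono p"
    and "\<And>j. p j > 0"
    and "p sums 1"
  shows "((\<exists>v::real. occupancy_variance M X \<longlonglongrightarrow> v)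
            \<longleftrightarrow> (\<exists>k\<ge>1. (\<lambda>j. p (j + k) / p j) \<longlonglongrightarrow> 1/2))
       \<and> (\<forall>k\<ge>1. ((\<lambda>j. p (j + k) / p j) \<longlonglongrightarrow> 1/2)
            \<longrightarrow> occupancy_variance M X \<longlonglongrightarrow> real k)"
proof -
  interpret occupancy_scheme M p X
    using assms by (simp add: occupancy_scheme_def occupancy_scheme_axioms_def box_frequencies_def)
  note V_iff = variance_tendsto_iff_growth_tendsto[OF occupancy_variance_ge occupancy_variance_le]
  have sufficient: "occupancy_variance M X \<longlonglongrightarrow> real k" if "(\<lambda>j. p (j + k) / p j) \<longlonglongrightarrow> 1/2" for k
    using that growth_tendsto_of_ratio[of k] by (simp add: V_iff ratio_tendsto_iff)
  have necessary: "\<exists>k\<ge>1. (\<lambda>j. p (j + k) / p j) \<longlonglongrightarrow> 1/2" if "occupancy_variance M X \<longlonglongrightarrow> v" for v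
    using that ratio_tendsto_of_growth[of v] unfolding V_iff ratio_tendsto_iff by blast
  show ?thesis
    using sufficient necessary by blast
qed

end
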